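(* For any $\mu_0 \in \mathbb{R}^d$ and $\sigma > 0$, let $\alpha^\star$ be given by $$\alpha^\star = \operatorname{argmax}_{\alpha \geq 0} \big\| \nabla_{\mu_0} \mathrm{MMD}^2_\alpha(\pi_{0,\sigma}, \pi_{\mu_0,\sigma}) \big\|.$$ Then, we have that $$\alpha^\star = \mathrm{ReLU}\big( \|\mu_0\|^2/(d+2) - 2\sigma^2 \big)^{1/2}.$$
   Context: $\|\cdot\|$ is the Euclidean norm on $\mathbb{R}^d$ and $\nabla_{\mu_0}$ is the gradient with respect to $\mu_0$. The kernel $k_\alpha$ is the normalized Gaussian kernel $k_\alpha(x,y) = \alpha^{-d} \exp[-\|x-y\|^2/(2\alpha^2)]$ for $x,y \in \mathbb{R}^d$. For any $\mu \in \mathbb{R}^d$ and $\sigma > 0$, $\pi_{\mu,\sigma}$ denotes the Gaussian distribution on $\mathbb{R}^d$ with mean $\mu$ and covariance matrix $\sigma^2 \mathrm{Id}$. $\mathrm{MMD}_\alpha$ is the Maximum Mean Discrepancy associated with $k_\alpha$; for any $\mu_1, \mu_2 \in \mathbb{R}^d$ and $\sigma_1, \sigma_2 > 0$, $$\mathrm{MMD}^2_\alpha(\pi_{\mu_1,\sigma_1},\pi_{\mu_2,\sigma_2}) = \mathbb{E}_{\pi_{\mu_1,\sigma_1} \otimes \pi_{\mu_1,\sigma_1}}[k_\alpha(X,X')] - 2\,\mathbb{E}_{\pi_{\mu_1,\sigma_1} \otimes \pi_{\mu_2,\sigma_2}}[k_\alpha(X,Y)] + \mathbb{E}_{\pi_{\mu_2,\sigma_2}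 \otimes \pi_{\mu_2,\sigma_2}}[k_\alpha(Y,Y')].$$ $\mathrm{ReLU}(x) = \max(x,0)$ for $x \in \mathbb{R}$.
   Formalization: At α = 0, where the kernel is undefined, MMD² is taken as its limit as α → 0+; the stated value is shown to be a maximiser for every μ0 and the unique one when μ0 ≠ 0 (for μ0 = 0 the gradient is zero for every α, so every α ≥ 0 is a maximiser). *)

theory Defs
  imports "HOL-Analysis.Analysis"
begin

definition gauss_kernel :: "real \<Rightarrow> real ^ 'd \<Rightarrow> real ^ 'd \<Rightarrow> real" where
  "gauss_kernel \<alpha> x y = 1 / \<alpha> ^ CARD('d) * exp (- (norm (x - y))\<^sup>2 / (2 * \<alpha>\<^sup>2))"

text \<open>The normal distribution with mean \<open>\<mu>\<close> and covariance matrix \<open>\<sigma>\<^sup>2 Id\<close> (for \<open>\<sigma> > 0\<close>).\<close>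

definition gaussian :: "real ^ 'd \<Rightarrow> real \<Rightarrow> (real ^ 'd) measure" where
  "gaussian \<mu> \<sigma> = density lborel
     (\<lambda>x. ennreal (1 / sqrt ((2 * pi * \<sigma>\<^sup>2) ^ CARD('d)) * exp (- (norm (x - \<mu>))\<^sup>2 / (2 * \<sigma>\<^sup>2))))"

definition mean_kernel :: "real \<Rightarrow> (real ^ 'd) measure \<Rightarrow> (real ^ 'd) measure \<Rightarrow> real" where
  "mean_kernel \<alpha> P Q = (\<integral>z. gauss_kernel \<alpha> (fst z) (snd z) \<partial>(P \<Otimes>\<^sub>M Q))"

definition mmd_sq_pos :: "real \<Rightarrow> (real ^ 'd) measure \<Rightarrow> (real ^ 'd) measure \<Rightarrow> real" where
  "mmd_sq_pos \<alpha> P Q = mean_kernel \<alpha> P P - 2 * mean_kernel \<alpha> P Q + mean_kernel \<alpha> Q Q"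

text \<open>The kernel is only meaningful for \<open>\<alpha> > 0\<close>; the literal formula at \<open>\<alpha> = 0\<close> would give \<open>0\<close>
  because of the convention \<open>x / 0 = 0\<close>. The value at bandwidth \<open>0\<close> is therefore the limit
  as \<open>\<alpha>\<close> tends to \<open>0\<close> from the right.\<close>

definition mmd_sq :: "real \<Rightarrow> (real ^ 'd) measure \<Rightarrow> (real ^ 'd) measure \<Rightarrow> real" where
  "mmd_sq \<alpha> P Q =
     (if \<alpha> = 0 then Lim (at_right 0) (\<lambda>a. mmd_sq_pos a P Q) else mmd_sq_pos \<alpha> P Q)"

definition gradient :: "('a::real_inner \<Rightarrow> real) \<Rightarrow> 'a \<Rightarrow> 'a" where
  "gradient f x = (THE D. GDERIV f x :> D)"

definition ReLU :: "real \<Rightarrow> real" where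
  "ReLU x = max x 0"

end

theory Submission
  imports Defs "HOL-Probability.Distributions"
begin

text \<open>The kernel is, up to the factor \<open>sqrt (2 * pi) ^ d\<close>, the density of a centred isotropic
  normal distribution of variance \<open>\<alpha>\<^sup>2\<close>. Such densities are closed under convolution and variances
  add up, so with \<open>s = \<alpha>\<^sup>2 + 2 * \<sigma>\<^sup>2\<close> the squared discrepancy between the two normal distributions is
  \<open>2 * s powr (- d / 2) * (1 - exp (- (norm \<mu>)\<^sup>2 / (2 * s)))\<close>, and its gradient has norm
  \<open>2 * norm \<mu> * s powr (- (d + 2) / 2) * exp (- (norm \<mu>)\<^sup>2 / (2 * s))\<close>. As a function of \<open>s > 0\<close>
  the latter increases up to \<open>s = (norm \<mu>)\<^sup>2 / (d + 2)\<close> and decreases afterwards, while \<open>s\<close> ranges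
  over the half-line \<open>s \<ge> 2 * \<sigma>\<^sup>2\<close>.\<close>

section \<open>Isotropic normal densities and their convolution\<close>

definition iso_density :: "real \<Rightarrow> 'a::euclidean_space \<Rightarrow> real" where
  "iso_density s x = exp (- (norm x)\<^sup>2 / (2 * s)) / sqrt (2 * pi * s) ^ DIM('a)"

lemma iso_density_nonneg: "s > 0 \<Longrightarrow> iso_density s x \<ge> 0"
  by (simp add: iso_density_def)

lemma iso_density_minus_commute: "iso_density s (x - y) = iso_density s (y - x)"
  by (simp add: iso_density_def norm_minus_commute)

lemma iso_density_measurable [measurable]: "iso_density s \<in> borel_measurable borel"
  unfolding iso_density_def by measurable

text \<open>The density is a product of one-dimensional normal densities along the standard basis,
  so its integral splits into factors equal to 1.\<close>

lemma nn_integral_iso_density: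
  fixes w :: "'a::euclidean_space"
  assumes "s > 0"
  shows "(\<integral>\<^sup>+x. ennreal (iso_density s (x - w)) \<partial>lborel) = 1"
proof -
  have factor: "ennreal (iso_density s (x - w)) =
      (\<Prod>b\<in>Basis. ennreal (normal_density (w \<bullet> b) (sqrt s) (x \<bullet> b)))" for x :: 'a
  proof -
    have "(\<Prod>b\<in>Basis. normal_density (w \<bullet> b) (sqrt s) (x \<bullet> b)) =
        exp (\<Sum>b\<in>Basis. - (x \<bullet> b - w \<bullet> b)\<^sup>2 / (2 * s)) / sqrt (2 * pi * s) ^ DIM('a)"
      using assms by (simp add: normal_density_def prod_dividef exp_sum)
    also have "(\<Sum>b\<in>Basis. - (x \<bullet> b - w \<bullet> b)\<^sup>2 / (2 * s)) = - (norm (x - w))\<^sup>2 / (2 * s)"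
      unfolding power2_norm_eq_inner euclidean_inner[of "x - w" "x - w"]
      by (simp add: inner_diff_left power2_eq_square sum_negf sum_divide_distrib)
    finally show ?thesis
      by (simp add: iso_density_def prod_ennreal)
  qed
  have "(\<integral>\<^sup>+t. ennreal (normal_density m (sqrt s) t) \<partial>lborel) = 1" for m
    using assms by (simp add: nn_integral_eq_integral integrable_normal_density integral_normal_density)
  then show ?thesis
    unfolding factor by (subst nn_integral_lborel_prod) auto
qed

text \<open>Scalar core of the product formula below, with \<open>A\<close>, \<open>B\<close> the
  squared norms of \<open>x - w\<close> and \<open>u - v\<close>, and \<open>C\<close> their inner
  product. The cross terms are \<open>C / (s + t)\<close> and its negative, so they cancel.\<close>

lemma complete_square:
  fixes s t A B C :: real
  assumes "s > 0" "t > 0"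
  shows "- (A - 2 * (s / (s + t)) * C + (s / (s + t))\<^sup>2 * B) / (2 * s) +
      - (A + 2 * (t / (s + t)) * C + (t / (s + t))\<^sup>2 * B) / (2 * t) =
    - B / (2 * (s + t)) + - A / (2 * (s * t / (s + t)))"
proof -
  define r where "r = s + t"
  have pos: "r > 0" using assms by (simp add: r_def)
  have "- (A - 2 * (s / r) * C + (s / r)\<^sup>2 * B) / (2 * s) = - A / (2 * s) + C / r - s * (B / (2 * r\<^sup>2))"
    "- (A + 2 * (t / r) * C + (t / r)\<^sup>2 * B) / (2 * t) = - A / (2 * t) - C / r - t * (B / (2 * r\<^sup>2))"
    using assms pos by (simp_all add: field_simps power2_eq_square)
  moreover have "s * (B / (2 * r\<^sup>2)) + t * (B / (2 * r\<^sup>2)) = B / (2 * r)"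
    using pos by (simp add: power2_eq_square flip: r_def distrib_right add_divide_distrib)
  moreover have "A / (2 * s) + A / (2 * t) = A / (2 * (s * t / r))"
    using assms pos by (simp add: r_def field_simps)
  ultimately show ?thesis
    unfolding r_def[symmetric] by simp
qed

lemma iso_density_mult:
  fixes u v x :: "'a::euclidean_space"
  assumes "s > 0" "t > 0"
  shows "iso_density s (x - u) * iso_density t (x - v) =
    iso_density (s + t) (u - v) *
    iso_density (s * t / (s + t)) (x - (t *\<^sub>R u + s *\<^sub>R v) /\<^sub>R (s + t))"
proof -
  \<comment> \<open>The mean of \<open>u\<close> and \<open>v\<close> weighted by inverse variances:
    the one centre for which the terms linear in \<open>x - w\<close> cancel.\<close>
  define w where "w = (t *\<^sub>R u + s *\<^sub>R v) /\<^sub>R (s + t)"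
  have pos: "s + t > 0" "s + t \<noteq> 0" "s \<noteq> 0" "t \<noteq> 0" using assms by auto
  have "(x - u) = (x - w) - (s / (s + t)) *\<^sub>R (u - v)"
       "(x - v) = (x - w) + (t / (s + t)) *\<^sub>R (u - v)"
  proof -
    have "(s / (s + t)) *\<^sub>R u + (t / (s + t)) *\<^sub>R u = u" "(s / (s + t)) *\<^sub>R v + (t / (s + t)) *\<^sub>R v = v"
      using pos by (simp_all flip: scaleR_add_left add_divide_distrib)
    moreover have "w = (t / (s + t)) *\<^sub>R u + (s / (s + t)) *\<^sub>R v"
      by (simp add: w_def scaleR_add_right divide_inverse mult.commute)
    ultimately show "(x - u) = (x - w) - (s / (s + t)) *\<^sub>R (u - v)"
       "(x - v) = (x - w) + (t / (s + t)) *\<^sub>R (u - v)"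
      by (simp_all add: scaleR_diff_right algebra_simps)
  qed
  moreover have diff: "(norm (y - c *\<^sub>R z))\<^sup>2 = (norm y)\<^sup>2 - 2 * c * (y \<bullet> z) + c\<^sup>2 * (norm z)\<^sup>2"
    and plus: "(norm (y + c *\<^sub>R z))\<^sup>2 = (norm y)\<^sup>2 + 2 * c * (y \<bullet> z) + c\<^sup>2 * (norm z)\<^sup>2"
    for c :: real and y z :: 'a
    unfolding power2_norm_eq_inner
    by (simp_all add: inner_diff inner_add inner_commute[of z y] power2_eq_square algebra_simps)
  ultimately have "(norm (x - u))\<^sup>2 = (norm (x - w))\<^sup>2 - 2 * (s / (s + t)) * ((x - w) \<bullet> (u - v))
        + (s / (s + t))\<^sup>2 * (norm (u - v))\<^sup>2"
     "(norm (x - v))\<^sup>2 = (norm (x - w))\<^sup>2 + 2 * (t / (s + t)) * ((x - w) \<bullet> (u - v))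
        + (t / (s + t))\<^sup>2 * (norm (u - v))\<^sup>2"
    by (simp_all only: diff plus)
  then have sq: "- (norm (x - u))\<^sup>2 / (2 * s) + - (norm (x - v))\<^sup>2 / (2 * t) =
     - (norm (u - v))\<^sup>2 / (2 * (s + t)) + - (norm (x - w))\<^sup>2 / (2 * (s * t / (s + t)))"
    by (simp only: complete_square[OF assms])
  \<comment> \<open>The normalising constants match as well, since the product of the two new
    variances is again \<open>s * t\<close>.\<close>
  have "(2 * pi * s) * (2 * pi * t) = (2 * pi * (s + t)) * (2 * pi * (s * t / (s + t)))"
    using pos by (simp add: field_simps)
  then have "sqrt (2 * pi * s) ^ DIM('a) * sqrt (2 * pi * t) ^ DIM('a) =
      sqrt (2 * pi * (s + t)) ^ DIM('a) * sqrt (2 * pi * (s * t / (s + t))) ^ DIM('a)"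
    by (metis power_mult_distrib real_sqrt_mult)
  then show ?thesis
    unfolding iso_density_def w_def[symmetric] times_divide_times_eq exp_add[symmetric] sq by simp
qed

text \<open>In the product formula only the second factor depends on \<open>x\<close>, and it
  integrates to 1.\<close>

lemma iso_density_convolution:
  fixes u v :: "'a::euclidean_space"
  assumes "s > 0" "t > 0"
  shows "(\<integral>\<^sup>+x. ennreal (iso_density s (x - u) * iso_density t (x - v)) \<partial>lborel) =
    ennreal (iso_density (s + t) (u - v))"
proof -
  have "s * t / (s + t) > 0" using assms by simp
  then show ?thesis
    unfolding iso_density_mult[OF assms]
    using assms by (simp add: ennreal_mult' iso_density_nonneg nn_integral_cmult nn_integral_iso_density)
qed

section \<open>The discrepancy between two normal distributions in closed form\<close>

lemma gaussian_eq_density: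
  fixes \<mu> :: "real ^ 'd"
  assumes "\<sigma> > 0"
  shows "gaussian \<mu> \<sigma> = density lborel (\<lambda>x. ennreal (iso_density (\<sigma>\<^sup>2) (x - \<mu>)))"
  by (simp add: gaussian_def iso_density_def real_sqrt_power)

lemma gauss_kernel_eq:
  fixes x y :: "real ^ 'd"
  assumes "\<alpha> > 0"
  shows "gauss_kernel \<alpha> x y = sqrt (2 * pi) ^ CARD('d) * iso_density (\<alpha>\<^sup>2) (x - y)"
  using assms by (simp add: gauss_kernel_def iso_density_def real_sqrt_mult power_mult_distrib)

lemma prob_space_gaussian:
  fixes \<mu> :: "real ^ 'd"
  assumes "\<sigma> > 0"
  shows "prob_space (gaussian \<mu> \<sigma>)"
  using assms by (intro prob_spaceI) (simp add: gaussian_eq_density emeasure_density nn_integral_iso_density)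

text \<open>By Tonelli, integrating out \<open>y\<close> raises the variance from
  \<open>\<alpha>\<^sup>2\<close> by \<open>\<sigma>2\<^sup>2\<close>, and integrating out
  \<open>x\<close> then adds \<open>\<sigma>1\<^sup>2\<close>. The kernel's extra factor
  \<open>sqrt (2 * pi) ^ CARD('d)\<close> cancels against the normalisation of the resulting
  density.\<close>

lemma mean_kernel_gaussian:
  fixes \<mu>1 \<mu>2 :: "real ^ 'd"
  assumes "\<alpha> > 0" "\<sigma>1 > 0" "\<sigma>2 > 0"
  shows "mean_kernel \<alpha> (gaussian \<mu>1 \<sigma>1) (gaussian \<mu>2 \<sigma>2) =
    exp (- (norm (\<mu>1 - \<mu>2))\<^sup>2 / (2 * (\<alpha>\<^sup>2 + \<sigma>1\<^sup>2 + \<sigma>2\<^sup>2))) / sqrt (\<alpha>\<^sup>2 + \<sigma>1\<^sup>2 + \<sigma>2\<^sup>2) ^ CARD('d)"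
proof -
  let ?P = "gaussian \<mu>1 \<sigma>1" and ?Q = "gaussian \<mu>2 \<sigma>2"
  let ?c = "sqrt (2 * pi) ^ CARD('d)"
  let ?k = "\<lambda>z::(real ^ 'd) \<times> (real ^ 'd). ?c * iso_density (\<alpha>\<^sup>2) (fst z - snd z)"
  interpret Q: prob_space ?Q using assms by (simp add: prob_space_gaussian)
  have sets [measurable_cong]: "sets ?P = sets borel" "sets ?Q = sets borel"
    by (simp_all add: gaussian_def)
  have inner: "(\<integral>\<^sup>+y. ennreal (?k (x, y)) \<partial>?Q) =
      ennreal (?c * iso_density (\<alpha>\<^sup>2 + \<sigma>2\<^sup>2) (x - \<mu>2))" for x
  proof -
    have "(\<integral>\<^sup>+y. ennreal (?k (x, y)) \<partial>?Q) =
      (\<integral>\<^sup>+y. ennreal ?c * ennreal (iso_density (\<alpha>\<^sup>2) (y - x) * iso_density (\<sigma>2\<^sup>2) (y - \<mu>2)) \<partial>lborel)"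
      using assms unfolding gaussian_eq_density[OF assms(3)]
      by (subst nn_integral_density)
        (auto intro!: nn_integral_cong simp: ennreal_mult' iso_density_nonneg ac_simps
          iso_density_minus_commute[of _ x])
    also have "\<dots> = ennreal ?c * ennreal (iso_density (\<alpha>\<^sup>2 + \<sigma>2\<^sup>2) (x - \<mu>2))"
      using assms by (simp add: nn_integral_cmult iso_density_convolution)
    finally show ?thesis by (simp add: ennreal_mult')
  qed
  have "(\<integral>\<^sup>+z. ennreal (?k z) \<partial>(?P \<Otimes>\<^sub>M ?Q)) = (\<integral>\<^sup>+x. \<integral>\<^sup>+y. ennreal (?k (x, y)) \<partial>?Q \<partial>?P)"
    by (rule Q.nn_integral_fst[symmetric]) measurable
  also have "\<dots> = (\<integral>\<^sup>+x. ennreal (?c * iso_density (\<alpha>\<^sup>2 + \<sigma>2\<^sup>2) (x - \<mu>2)) \<partial>?P)"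
    by (simp only: inner)
  also have "\<dots> = (\<integral>\<^sup>+x. ennreal ?c *
      ennreal (iso_density (\<sigma>1\<^sup>2) (x - \<mu>1) * iso_density (\<alpha>\<^sup>2 + \<sigma>2\<^sup>2) (x - \<mu>2)) \<partial>lborel)"
    using assms unfolding gaussian_eq_density[OF assms(2)]
    by (subst nn_integral_density)
      (auto intro!: nn_integral_cong simp: ennreal_mult' iso_density_nonneg add_pos_pos ac_simps)
  also have "\<dots> = ennreal (?c * iso_density (\<alpha>\<^sup>2 + \<sigma>1\<^sup>2 + \<sigma>2\<^sup>2) (\<mu>1 - \<mu>2))"
    using assms by (simp add: nn_integral_cmult iso_density_convolution add_pos_pos ennreal_mult' ac_simps)
  finally have "(\<integral>z. ?k z \<partial>(?P \<Otimes>\<^sub>M ?Q)) = ?c * iso_density (\<alpha>\<^sup>2 + \<sigma>1\<^sup>2 + \<sigma>2\<^sup>2) (\<mu>1 - \<mu>2)"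
    using assms by (subst integral_eq_nn_integral) (auto simp: iso_density_nonneg add_pos_pos)
  then show ?thesis
    using assms by (simp add: mean_kernel_def gauss_kernel_eq iso_density_def real_sqrt_mult power_mult_distrib)
qed

lemma mmd_sq_gaussian:
  fixes \<mu> :: "real ^ 'd"
  assumes "\<sigma> > 0" "\<alpha> \<ge> 0"
  shows "mmd_sq \<alpha> (gaussian 0 \<sigma>) (gaussian \<mu> \<sigma>) =
    2 / sqrt (\<alpha>\<^sup>2 + 2 * \<sigma>\<^sup>2) ^ CARD('d) * (1 - exp (- (norm \<mu>)\<^sup>2 / (2 * (\<alpha>\<^sup>2 + 2 * \<sigma>\<^sup>2))))"
    (is "_ = ?m \<alpha>")
proof -
  have pos: "mmd_sq_pos a (gaussian 0 \<sigma>) (gaussian \<mu> \<sigma>) = ?m a" if "a > 0" for a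
    using that assms by (simp add: mmd_sq_pos_def mean_kernel_gaussian algebra_simps)
  \<comment> \<open>Since \<open>2 * \<sigma>\<^sup>2 > 0\<close>, the closed form is continuous at
    bandwidth 0, so the limit defining \<open>mmd_sq 0\<close> is its value there.\<close>
  have "(?m \<longlongrightarrow> ?m 0) (at_right 0)"
    using assms by (intro tendsto_intros) auto
  then have "((\<lambda>a. mmd_sq_pos a (gaussian 0 \<sigma>) (gaussian \<mu> \<sigma>)) \<longlongrightarrow> ?m 0) (at_right 0)"
    by (rule Lim_transform_eventually)
      (auto simp: pos eventually_at_right_less intro!: eventually_mono[OF eventually_at_right_less[of 0]])
  then show ?thesis
    using assms pos[of \<alpha>] by (auto simp: mmd_sq_def intro!: tendsto_Lim)
qed

section \<open>The gradient of the discrepancy in the mean\<close>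

lemma gradient_eqI:
  assumes "GDERIV f x :> D"
  shows "gradient f x = D"
  unfolding gradient_def
proof (rule the_equality[of _ D])
  fix E assume "GDERIV f x :> E"
  with assms have "(\<lambda>h. h \<bullet> E) = (\<lambda>h. h \<bullet> D)"
    unfolding gderiv_def by (rule has_derivative_unique[rotated])
  then show "E = D"
    \<comment> \<open>Evaluating both functionals at \<open>E - D\<close> makes the squared norm of
      \<open>E - D\<close> vanish.\<close>
    by (metis inner_diff_right inner_eq_zero_iff right_minus_eq)
qed (fact assms)

lemma norm_gradient_mmd_sq_gaussian:
  fixes \<mu> :: "real ^ 'd"
  assumes "\<sigma> > 0" "\<alpha> \<ge> 0"
  defines "s \<equiv> \<alpha>\<^sup>2 + 2 * \<sigma>\<^sup>2"
  shows "norm (gradient (\<lambda>\<mu>. mmd_sq \<alpha> (gaussian 0 \<sigma>) (gaussian \<mu> \<sigma>)) \<mu>) =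
    2 * norm \<mu> * (exp (- (norm \<mu>)\<^sup>2 / (2 * s)) / sqrt s ^ (CARD('d) + 2))"
proof -
  have s: "s > 0" using assms by (simp add: s_def add_nonneg_pos)
  \<comment> \<open>Writing the squared norm as an inner product keeps the differentiation valid at
    the origin too. The chain rule contributes \<open>1 / s\<close>, which raises the exponent of
    \<open>sqrt s\<close> by 2.\<close>
  have "GDERIV (\<lambda>\<mu>::real ^ 'd. 2 / sqrt s ^ CARD('d) * (1 - exp (- (\<mu> \<bullet> \<mu>) / (2 * s)))) \<mu> :>
      (2 * exp (- (\<mu> \<bullet> \<mu>) / (2 * s)) / sqrt s ^ (CARD('d) + 2)) *\<^sub>R \<mu>"
    unfolding gderiv_def
    using s by (auto intro!: derivative_eq_intros ext simp: inner_commute power_add field_simps)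
  then have "gradient (\<lambda>\<mu>. mmd_sq \<alpha> (gaussian 0 \<sigma>) (gaussian \<mu> \<sigma>)) \<mu> =
      (2 * exp (- (\<mu> \<bullet> \<mu>) / (2 * s)) / sqrt s ^ (CARD('d) + 2)) *\<^sub>R \<mu>"
    using assms by (intro gradient_eqI) (simp add: mmd_sq_gaussian s_def power2_norm_eq_inner)
  then show ?thesis
    using s by (simp add: power2_norm_eq_inner)
qed

section \<open>Maximisation over the half-line of variances\<close>

text \<open>After taking logarithms, the claim follows from \<open>ln x < x - 1\<close> at
  \<open>x = t / s\<close>, combined with the first-order optimality condition at \<open>t\<close>;
  no monotonicity analysis is required.\<close>

lemma exp_div_power_less:
  fixes m b s :: real
  assumes "b > 0" "n > 0" "s \<ge> b" 
  defines "t \<equiv> max (m / real n) b"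
  assumes "s \<noteq> t"
  shows "exp (- m / (2 * s)) / sqrt s ^ n < exp (- m / (2 * t)) / sqrt t ^ n"
proof -
  have pos: "s > 0" "t > 0" using assms by auto
  \<comment> \<open>First-order condition: at an unconstrained maximiser the first factor is 0; at
    the boundary \<open>t = b\<close> both factors are nonpositive.\<close>
  have "(m / t - n) * (t / s - 1) \<ge> 0"
  proof (cases "m / n \<ge> b")
    case True
    then have "m / t = n" using assms pos by (auto simp: max_def field_simps)
    then show ?thesis by simp
  next
    case False
    then have "t = b" "m / t \<le> n" using assms by (auto simp: field_simps)
    moreover have "t / s \<le> 1" using assms \<open>t = b\<close> pos by simp
    ultimately show ?thesis by (intro mult_nonpos_nonpos) auto
  qed
  \<comment> \<open>Strict because \<open>t / s\<close> differs from 1; this is the source of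
    uniqueness.\<close>
  moreover have "ln (t / s) < t / s - 1"
    using pos assms ln_le_minus_one[of "t / s"] ln_eq_minus_one[of "t / s"] by force
  then have "n * ln (t / s) < n * (t / s - 1)"
    using assms by simp
  moreover have "(m / t - n) * (t / s - 1) = m / s - m / t - n * (t / s - 1)"
    using pos by (simp add: left_diff_distrib right_diff_distrib diff_divide_distrib)
  ultimately have "n * (ln t - ln s) < m / s - m / t"
    using pos by (simp add: ln_div)
  then have "- m / (2 * s) - n * ln (sqrt s) < - m / (2 * t) - n * ln (sqrt t)"
    using pos by (simp add: ln_sqrt field_simps)
  then have "exp (- m / (2 * s) - n * ln (sqrt s)) < exp (- m / (2 * t) - n * ln (sqrt t))"
    by simp
  then show ?thesis
    using pos by (simp add: exp_diff exp_of_nat_mult)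
qed

text \<open>Uniqueness is claimed for \<open>\<mu>0 \<noteq> 0\<close> only: at
  \<open>\<mu>0 = 0\<close> the gradient vanishes for every bandwidth, so each
  \<open>\<alpha> \<ge> 0\<close> is a maximiser.\<close>

theorem proposition3p1:
  fixes \<mu>0 :: "real ^ 'd" and \<sigma> :: real
  assumes "\<sigma> > 0"
  shows "let F = (\<lambda>\<alpha>. norm (gradient (\<lambda>\<mu>. mmd_sq \<alpha> (gaussian 0 \<sigma>) (gaussian \<mu> \<sigma>)) \<mu>0));
             \<alpha>_star = sqrt (ReLU ((norm \<mu>0)\<^sup>2 / (real CARD('d) + 2) - 2 * \<sigma>\<^sup>2))
         in is_arg_max F (\<lambda>\<alpha>. \<alpha> \<ge> 0) \<alpha>_star \<and>
            (\<mu>0 \<noteq> 0 \<longrightarrow> (\<forall>\<alpha>. is_arg_max F (\<lambda>\<alpha>. \<alpha> \<ge> 0) \<alpha> \<longrightarrow> \<alpha> = \<alpha>_star))"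
proof -
  define F where "F = (\<lambda>\<alpha>. norm (gradient (\<lambda>\<mu>. mmd_sq \<alpha> (gaussian 0 \<sigma>) (gaussian \<mu> \<sigma>)) \<mu>0))"
  define a where "a = sqrt (ReLU ((norm \<mu>0)\<^sup>2 / (real CARD('d) + 2) - 2 * \<sigma>\<^sup>2))"
  have F: "F \<alpha> = 2 * norm \<mu>0 *
      (exp (- (norm \<mu>0)\<^sup>2 / (2 * (\<alpha>\<^sup>2 + 2 * \<sigma>\<^sup>2))) / sqrt (\<alpha>\<^sup>2 + 2 * \<sigma>\<^sup>2) ^ (CARD('d) + 2))"
    if "\<alpha> \<ge> 0" for \<alpha>
    unfolding F_def by (rule norm_gradient_mmd_sq_gaussian[OF assms that])
  have a: "a \<ge> 0" by (simp add: a_def ReLU_def)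
  \<comment> \<open>Shifting the ReLU by \<open>2 * \<sigma>\<^sup>2\<close> turns it into the
    clipped maximiser \<open>t\<close> of \<open>exp_div_power_less\<close>.\<close>
  have a2: "a\<^sup>2 + 2 * \<sigma>\<^sup>2 = max ((norm \<mu>0)\<^sup>2 / real (CARD('d) + 2)) (2 * \<sigma>\<^sup>2)"
    by (simp add: a_def ReLU_def max_def add.commute)
  have less: "F \<alpha> < F a" if "\<alpha> \<ge> 0" "\<alpha> \<noteq> a" "\<mu>0 \<noteq> 0" for \<alpha>
  proof -
    \<comment> \<open>Squaring is injective on nonnegative bandwidths, so distinct bandwidths give
      distinct variances.\<close>
    have "\<alpha>\<^sup>2 + 2 * \<sigma>\<^sup>2 \<noteq> a\<^sup>2 + 2 * \<sigma>\<^sup>2"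
      using that a by (simp add: power2_eq_iff_nonneg)
    with exp_div_power_less[of "2 * \<sigma>\<^sup>2" "CARD('d) + 2" "\<alpha>\<^sup>2 + 2 * \<sigma>\<^sup>2" "(norm \<mu>0)\<^sup>2", folded a2]
    show ?thesis
      unfolding F[OF that(1)] F[OF a] using that(3) assms
      by (intro mult_strict_left_mono) simp_all
  qed
  have "F \<alpha> \<le> F a" if "\<alpha> \<ge> 0" for \<alpha>
    using less[OF that] a that by (cases "\<mu>0 = 0"; cases "\<alpha> = a") (auto simp: F)
  then have "is_arg_max F (\<lambda>\<alpha>. \<alpha> \<ge> 0) a"
    using a by (auto simp: is_arg_max_def not_less)
  moreover have "\<alpha> = a" if "\<mu>0 \<noteq> 0" "is_arg_max F (\<lambda>\<alpha>. \<alpha> \<ge> 0) \<alpha>" for \<alpha>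
    using that less a by (auto simp: is_arg_max_def)
  ultimately show ?thesis
    unfolding Let_def F_def[symmetric] a_def[symmetric] by blast
qed

end
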